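(* The real number $\pi$ is irrational.
   Context: Here $\sin x := x - \frac{x^3}{3!} + \frac{x^5}{5!} - \frac{x^7}{7!} + \cdots$ for real $x$, and $\pi$ is defined to be the smallest positive real number such that $\sin \pi = 0$ (this agrees with the usual geometric definition of $\pi$). *)

theory Defs
  imports Complex_Main
begin

text \<open>
  The library defines \<open>sin\<close> by its power series, but \<open>pi\<close> as twice the unique zero of \<open>cos\<close>
  in the interval \<open>{0..2}\<close>. The two facts below show that these are the series
  \<open>x - x^3/3! + x^5/5! - ...\<close> and its smallest positive zero.
\<close>

lemma sin_real_sums:
  fixes x :: real
  shows "(\<lambda>n. (- 1) ^ n * x ^ (2 * n + 1) / fact (2 * n + 1)) sums sin x"
  using sin_paired [of x] by (simp add: field_simps)

lemma pi_eq_Least: "pi = (LEAST x::real. 0 < x \<and> sin x = 0)"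
proof (rule sym, rule Least_equality)
  show "0 < pi \<and> sin pi = 0" by simp
next
  fix y :: real
  assume "0 < y \<and> sin y = 0"
  then show "pi \<le> y"
    using sin_gt_zero [of y] by force
qed

end

theory Submission
  imports Defs "HOL-Computational_Algebra.Polynomial"
begin

text \<open>
  Niven's argument, with the mean value theorem in place of an integral. Suppose \<open>\<pi> = a / b\<close> and let
  \<open>p = x\<^sup>n (a - b x)\<^sup>n\<close> and \<open>F = p - p'' + p'''' - \<dots>\<close>. Then \<open>F' sin - F cos\<close> has the
  derivative \<open>p sin\<close>, so \<open>F(0) + F(\<pi>) = \<pi> p(\<xi>) sin \<xi>\<close> for some \<open>\<xi>\<close> between \<open>0\<close> and \<open>\<pi>\<close>.
  The right-hand side is positive and at most \<open>\<pi> (\<pi> a)\<^sup>n\<close>, which is below \<open>n!\<close> for large \<open>n\<close>;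
  the left-hand side is divisible by \<open>n!\<close>, since \<open>p\<close> has integer coefficients, vanishes to
  order \<open>n\<close> at \<open>0\<close> and is symmetric under \<open>x \<mapsto> \<pi> - x\<close>.
\<close>

lemma pderiv_sum: "pderiv (sum f A) = (\<Sum>x\<in>A. pderiv (f x))"
  using higher_pderiv_sum[of 1 f A] by simp

lemma poly_higher_pderiv_0:
  "poly ((pderiv ^^ k) p) 0 = fact k * coeff p k"
  by (simp add: poly_0_coeff_0 coeff_higher_pderiv pochhammer_fact)

lemma higher_pderiv_eq_0:
  fixes p :: "'a::{comm_semiring_1,semiring_no_zero_divisors,semiring_char_0} poly"
  assumes "degree p < k"
  shows "(pderiv ^^ k) p = 0"
  using assms by (intro poly_eqI) (simp add: coeff_higher_pderiv coeff_eq_0)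

text \<open>By the chain rule each derivative of p(c - x) brings out a factor -1; in pairs these
  cancel, so only even orders keep the symmetry.\<close>

lemma higher_pderiv_reflect:
  fixes p :: "'a::idom poly"
  assumes "pcompose p [:c, -1:] = p"
  shows "pcompose ((pderiv ^^ (2 * k)) p) [:c, -1:] = (pderiv ^^ (2 * k)) p"
proof (induction k)
  case 0
  show ?case by (simp add: assms)
next
  case (Suc k)
  define q where "q = (pderiv ^^ (2 * k)) p"
  have "pderiv (pderiv q) = pderiv (pderiv (pcompose q [:c, -1:]))"
    using Suc by (simp add: q_def)
  also have "\<dots> = pcompose (pderiv (pderiv q)) [:c, -1:]"
    by (simp add: pderiv_pcompose pderiv_pCons pderiv_minus)
  finally show ?case by (simp add: q_def)
qed

text \<open>Each term is divisible on its own: for 2k < n the coefficient vanishes, and otherwise n!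
  divides (2k)!.\<close>

lemma sum_fact_coeff_eq_fact_mult:
  fixes p :: "real poly"
  assumes "\<And>i. coeff p i \<in> \<int>" and "\<And>i. i < n \<Longrightarrow> coeff p i = 0"
  shows "\<exists>m::int. (\<Sum>k\<le>N. (-1) ^ k * (fact (2 * k) * coeff p (2 * k))) = fact n * of_int m"
proof -
  have "\<exists>m::int. (-1) ^ k * (fact (2 * k) * coeff p (2 * k)) = fact n * of_int m" for k
  proof (cases "2 * k < n")
    case True
    then show ?thesis using assms(2) by (intro exI[of _ 0]) simp
  next
    case False
    then have "(fact n :: int) dvd fact (2 * k)" by (simp add: fact_dvd)
    then obtain d where "(fact (2 * k) :: int) = fact n * d" ..
    then have "real_of_int (fact (2 * k)) = real_of_int (fact n * d)" by (rule arg_cong)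
    then have d: "(fact (2 * k) :: real) = fact n * of_int d" by simp
    obtain c where "coeff p (2 * k) = of_int c" using assms(1) by (rule Ints_cases)
    then show ?thesis using d by (intro exI[of _ "(-1) ^ k * (d * c)"]) simp
  qed
  then obtain m where "\<And>k. (-1) ^ k * (fact (2 * k) * coeff p (2 * k)) = fact n * of_int (m k)"
    by metis
  then show ?thesis
    by (intro exI[of _ "\<Sum>k\<le>N. m k"]) (simp add: sum_distrib_left)
qed

text \<open>The sum is \<open>F(0)\<close>, which equals \<open>F(\<pi>)\<close> by symmetry.\<close>

lemma reflect_poly_mean_value:
  fixes p :: "real poly"
  assumes "pcompose p [:pi, -1:] = p" and "degree p \<le> 2 * n"
  shows "\<exists>\<xi>. 0 < \<xi> \<and> \<xi> < pi \<and>
    2 * (\<Sum>k\<le>n. (-1) ^ k * (fact (2 * k) * coeff p (2 * k))) = pi * (poly p \<xi> * sin \<xi>)"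
proof -
  define T where "T k = smult ((-1) ^ k) ((pderiv ^^ (2 * k)) p)" for k
  define F where "F = (\<Sum>k\<le>n. T k)"
  have "pderiv (pderiv (T k)) = - T (Suc k)" for k
    by (simp add: T_def pderiv_smult)
  then have "pderiv (pderiv F) = - (\<Sum>k\<le>n. T (Suc k))"
    by (simp add: F_def pderiv_sum sum_negf)
  also have "\<dots> = T 0 - (\<Sum>k\<le>Suc n. T k)"
    by (simp add: sum.atMost_Suc_shift del: sum.atMost_Suc)
  also have "\<dots> = T 0 - F - T (Suc n)" by (simp add: F_def)
  \<comment> \<open>The shifted sum leaves one surplus term, a derivative of order 2n + 2, which
    exceeds the degree.\<close>
  also have "T (Suc n) = 0"
    unfolding T_def using assms(2) by (subst higher_pderiv_eq_0) auto
  finally have F_ode: "pderiv (pderiv F) = p - F" by (simp add: T_def)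
  \<comment> \<open>At 0 and \<pi> the sine vanishes and the cosine is 1 and -1, so G(\<pi>) - G(0)
    = F(\<pi>) + F(0).\<close>
  define G where "G x = poly (pderiv F) x * sin x - poly F x * cos x" for x
  have "(G has_real_derivative poly p x * sin x) (at x)" for x
    unfolding G_def by (auto intro!: derivative_eq_intros simp: F_ode algebra_simps)
  then obtain \<xi> where \<xi>: "0 < \<xi>" "\<xi> < pi" "G pi - G 0 = pi * (poly p \<xi> * sin \<xi>)"
    using MVT2[of 0 pi G "\<lambda>x. poly p x * sin x"] by auto
  have "poly q (pi - x) = poly q x" if "pcompose q [:pi, -1:] = q" for q x
    using arg_cong[OF that, of "\<lambda>q. poly q x"] by (simp add: poly_pcompose)
  from this[OF higher_pderiv_reflect[OF assms(1)], where x = 0]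
  have "poly F pi = poly F 0" by (simp add: F_def T_def poly_sum)
  moreover have "poly F 0 = (\<Sum>k\<le>n. (-1) ^ k * (fact (2 * k) * coeff p (2 * k)))"
    by (simp add: F_def T_def poly_sum poly_higher_pderiv_0)
  ultimately show ?thesis using \<xi> by (auto simp: G_def)
qed

lemma coeff_monom_mult_power_Ints:
  "coeff (monom 1 n * [:of_int a, - of_int b:] ^ n) i \<in> (\<int> :: 'a::comm_ring_1 set)"
proof -
  have "coeff ([:of_int a, - of_int b:] ^ m) j \<in> (\<int> :: 'a set)" for m j
  proof (induction m arbitrary: j)
    case 0
    show ?case by (simp add: coeff_1)
  next
    case (Suc m)
    then show ?case by (cases j) (auto simp: coeff_pCons)
  qed
  then show ?thesis by (simp add: coeff_monom_mult)
qed

theorem theorem2: "(pi::real) \<notin> \<rat>"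
proof
  assume "pi \<in> \<rat>"
  then obtain a b :: int where b: "b > 0" and ab: "pi = of_int a / of_int b"
    by (elim Rats_cases') auto
  have a: "of_int a = pi * of_int b" using b ab by (simp add: field_simps)
  then have a0: "of_int a > (0::real)" using b by simp
  \<comment> \<open>Apart from the factor \<pi>, these are the terms of the convergent exponential
    series at \<open>pi * of_int a\<close>.\<close>
  have "(\<lambda>n. pi * (inverse (fact n) * (pi * of_int a) ^ n)) \<longlonglongrightarrow> pi * 0"
    by (intro tendsto_mult tendsto_const summable_LIMSEQ_zero summable_exp)
  then have "\<forall>\<^sub>F n in sequentially. pi * (inverse (fact n) * (pi * of_int a) ^ n) < 1"
    by (rule order_tendstoD(2)) simp
  then obtain n where "pi * (inverse (fact n) * (pi * of_int a) ^ n) < 1"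
    by (auto dest: eventually_happens)
  then have n: "pi * (pi * of_int a) ^ n < fact n" by (simp add: field_simps)
  define p :: "real poly" where "p = monom 1 n * [:of_int a, - of_int b:] ^ n"
  have poly_p: "poly p x = (x * (of_int a - of_int b * x)) ^ n" for x :: real
    by (simp add: p_def poly_monom power_mult_distrib mult.commute)
  \<comment> \<open>Since a = \<pi> b, the base x (a - b x) is b x (\<pi> - x).\<close>
  have "pcompose p [:pi, -1:] = p"
    unfolding poly_eq_poly_eq_iff[symmetric]
    by (rule ext) (simp add: poly_pcompose poly_p a algebra_simps)
  moreover have "degree p \<le> n + n" unfolding p_def
    by (intro order.trans[OF degree_mult_le] add_mono degree_monom_le
          order.trans[OF degree_power_le]) simp
  ultimately obtain \<xi> where \<xi>: "0 < \<xi>" "\<xi> < pi" and eq: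
    "2 * (\<Sum>k\<le>n. (-1) ^ k * (fact (2 * k) * coeff p (2 * k))) = pi * (poly p \<xi> * sin \<xi>)"
    using reflect_poly_mean_value[of p n] by auto
  have "coeff p i \<in> \<int>" for i
    unfolding p_def by (rule coeff_monom_mult_power_Ints)
  moreover have "coeff p i = 0" if "i < n" for i
    using that by (simp add: p_def coeff_monom_mult)
  ultimately obtain m where "(\<Sum>k\<le>n. (-1) ^ k * (fact (2 * k) * coeff p (2 * k))) = fact n * of_int m"
    using sum_fact_coeff_eq_fact_mult[of p n n] by blast
  with eq have m: "fact n * of_int (2 * m) = pi * (poly p \<xi> * sin \<xi>)" by simp
  have sin: "0 < sin \<xi>" "sin \<xi> \<le> 1" using \<xi> by (auto intro: sin_gt_zero)
  have pos: "0 < of_int a - of_int b * \<xi>" using \<xi> b by (simp add: a mult.commute)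
  then have "0 < poly p \<xi>" using \<xi> by (simp add: poly_p)
  with sin m have "0 < (fact n * of_int (2 * m) :: real)" by simp
  then have "0 < m" by (simp add: zero_less_mult_iff)
  \<comment> \<open>The two factors of the base are bounded separately: \<xi> by \<pi>, and a - b
    \<xi> by a.\<close>
  have "poly p \<xi> \<le> (pi * of_int a) ^ n"
    unfolding poly_p using \<xi> b pos by (intro power_mono mult_mono) auto
  then have "poly p \<xi> * sin \<xi> \<le> (pi * of_int a) ^ n * 1"
    using sin a0 by (intro mult_mono) auto
  then have "pi * (poly p \<xi> * sin \<xi>) \<le> pi * (pi * of_int a) ^ n" by simp
  with m n have "fact n * of_int (2 * m) < (fact n * 1 :: real)" by linarith
  then have "real_of_int (2 * m) < 1" by (simp only: mult_less_cancel_left_pos fact_gt_zero)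
  with \<open>0 < m\<close> show False by simp
qed

end
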